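(* Let $\mathcal X\subset\mathbb R^N$ be partitioned into $M$ cells $\mathcal C_1,\dots,\mathcal C_M$, each an axis-aligned closed hyperrectangle with side lengths $\Delta_1,\dots,\Delta_N>0$, let $\mathcal Y$ be a finite output set, let $p(\mathbf x)$ be a prior probability density on $\mathcal X$, let $\mathcal L(\mathbf x,\mathbf y_k)$ be the utility loss function, and let $\epsilon>0$ and $d_p$ be the $\ell_p$ distance, $p\in[1,\infty]$. Let $\hat{\mathcal L}^*$ be the optimal value of the linear program $\mathrm{APO}_{\mathrm{lb}}$ (defined in the context). Let $\mathcal M:\mathcal X\to\mathcal Y$ be any randomized mechanism satisfying $(\epsilon,d_p)$-mDP, and let $$\mathcal L(\mathcal M):=\int_{\mathcal X}\sum_{\mathbf y_k\in\mathcal Y}p(\mathbf x)\,\mathcal L(\mathbf x,\mathbf y_k)\,\Pr(\mathcal M(\mathbf x)=\mathbf y_k)\,\mathrm d\mathbf x$$ denote its expected utility loss. Then $$\mathcal L(\mathcal M)\ge\hat{\mathcal L}^*.$$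
   Context: A randomized mechanism $\mathcal M:\mathcal X\to\mathcal Y$ assigns to each $\mathbf x\in\mathcal X$ a probability distribution $\Pr(\mathcal M(\mathbf x)=\cdot)$ on $\mathcal Y$. It satisfies $(\epsilon,d_p)$-mDP (metric differential privacy) if $\Pr(\mathcal M(\mathbf x_a)=\mathbf y)\le e^{\epsilon d_p(\mathbf x_a,\mathbf x_b)}\Pr(\mathcal M(\mathbf x_b)=\mathbf y)$ for all $\mathbf x_a,\mathbf x_b\in\mathcal X$ and $\mathbf y\in\mathcal Y$ (equivalently, when probabilities are positive, $|\ln\Pr(\mathcal M(\mathbf x_a)=\mathbf y)-\ln\Pr(\mathcal M(\mathbf x_b)=\mathbf y)|\le\epsilon d_p(\mathbf x_a,\mathbf x_b)$). The cells have pairwise disjoint interiors and union $\mathcal X$. The function $\mathbf x\mapsto p(\mathbf x)\mathcal L(\mathbf x,\mathbf y_k)$ is measurable and attains its minimum on each cell. The inter-cell distance is $\hat d_p(\mathcal C_m,\mathcal C_{m'}):=\max_{\mathbf x\in\mathcal C_m,\,\mathbf x'\in\mathcal C_{m'}}d_p(\mathbf x,\mathbf x')$ and $\bar{\mathcal L}_m(\mathbf y_k):=\min_{\mathbf x\in\mathcal C_m}p(\mathbf x)\mathcal L(\mathbf x,\mathbf y_k)$. The linear program $\mathrm{APO}_{\mathrm{lb}}$ has real variables $z(\mathbf y_k\mid\mathcal C_m)$, $m=1,\dots,M$, $\mathbf y_k\in\mathcal Y$, and is: minimize $\sum_{m=1}^M\sum_{\mathbf y_k\in\mathcal Y}\bar{\mathcal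 L}_m(\mathbf y_k)\,z(\mathbf y_k\mid\mathcal C_m)$ subject to $z(\mathbf y_k\mid\mathcal C_m)-e^{\epsilon\hat d_p(\mathcal C_m,\mathcal C_{m'})}z(\mathbf y_k\mid\mathcal C_{m'})\le0$ for all $m,m'\in\{1,\dots,M\}$ and all $\mathbf y_k\in\mathcal Y$, and $\sum_{\mathbf y_k\in\mathcal Y}z(\mathbf y_k\mid\mathcal C_m)=\prod_{\ell=1}^N\Delta_\ell$ for all $m$. (The letter $p$ denotes both the norm exponent and, when written $p(\mathbf x)$, the prior density.) *)

theory Defs
  imports "HOL-Probability.Probability"
begin

definition lp_dist :: "ereal \<Rightarrow> real ^ 'n::finite \<Rightarrow> real ^ 'n \<Rightarrow> real" where
  "lp_dist q x y =
     (if q = \<infinity> then (MAX i. \<bar>x $ i - y $ i\<bar>)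
      else (\<Sum>i\<in>UNIV. \<bar>x $ i - y $ i\<bar> powr real_of_ereal q) powr (1 / real_of_ereal q))"

definition mechanism :: "'x set \<Rightarrow> 'y set \<Rightarrow> ('x \<Rightarrow> 'y pmf) \<Rightarrow> bool" where
  "mechanism X Y K \<longleftrightarrow> (\<forall>x\<in>X. set_pmf (K x) \<subseteq> Y)"

definition mDP :: "real \<Rightarrow> ('x \<Rightarrow> 'x \<Rightarrow> real) \<Rightarrow> 'x set \<Rightarrow> 'y set \<Rightarrow> ('x \<Rightarrow> 'y pmf) \<Rightarrow> bool" where
  "mDP \<epsilon> d X Y K \<longleftrightarrow>
     (\<forall>xa\<in>X. \<forall>xb\<in>X. \<forall>y\<in>Y. pmf (K xa) y \<le> exp (\<epsilon> * d xa xb) * pmf (K xb) y)"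

definition prior_density :: "'x::euclidean_space set \<Rightarrow> ('x \<Rightarrow> real) \<Rightarrow> bool" where
  "prior_density X p \<longleftrightarrow>
     p \<in> borel_measurable (lebesgue_on X) \<and> (\<forall>x\<in>X. 0 \<le> p x) \<and>
     (\<integral>\<^sup>+ x. ennreal (p x) \<partial>lebesgue_on X) = 1"

definition box_partition ::
  "(real ^ 'n::finite) set \<Rightarrow> nat \<Rightarrow> (nat \<Rightarrow> (real ^ 'n) set) \<Rightarrow> real ^ 'n \<Rightarrow> bool" where
  "box_partition X M C \<Delta> \<longleftrightarrow>
     (\<forall>i. 0 < \<Delta> $ i) \<and>
     (\<forall>m\<in>{1..M}. \<exists>a. C m = cbox a (a + \<Delta>)) \<and>
     disjoint_family_on (\<lambda>m. interior (C m)) {1..M} \<and>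
     (\<Union>m\<in>{1..M}. C m) = X"

(* The maximum of d over A \<times> B, written as a supremum because Max is limited to finite sets;
   it is attained for compact nonempty cells and continuous d. *)
definition cell_dist :: "('x \<Rightarrow> 'x \<Rightarrow> real) \<Rightarrow> 'x set \<Rightarrow> 'x set \<Rightarrow> real" where
  "cell_dist d A B = (SUP (x, x')\<in>A \<times> B. d x x')"

definition attains_min_on :: "('x \<Rightarrow> real) \<Rightarrow> 'x set \<Rightarrow> bool" where
  "attains_min_on f A \<longleftrightarrow> (\<exists>x\<in>A. \<forall>x'\<in>A. f x \<le> f x')"

(* The minimum over the cell A, used only when it is attained; see cell_loss_minimum. *)
definition cell_loss :: "('x \<Rightarrow> real) \<Rightarrow> ('x \<Rightarrow> 'y \<Rightarrow> real) \<Rightarrow> 'x set \<Rightarrow> 'y \<Rightarrow> real" where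
  "cell_loss p L A y = (INF x\<in>A. p x * L x y)"

lemma cell_loss_minimum:
  assumes "attains_min_on (\<lambda>x. p x * L x y) A"
  shows "\<exists>x\<in>A. cell_loss p L A y = p x * L x y"
    and "\<forall>x\<in>A. cell_loss p L A y \<le> p x * L x y"
proof -
  obtain a where a: "a \<in> A" "\<And>x. x \<in> A \<Longrightarrow> p a * L a y \<le> p x * L x y"
    using assms unfolding attains_min_on_def by blast
  have "cell_loss p L A y = p a * L a y"
    unfolding cell_loss_def using a by (intro cInf_eq_minimum) auto
  then show "\<exists>x\<in>A. cell_loss p L A y = p x * L x y"
    and "\<forall>x\<in>A. cell_loss p L A y \<le> p x * L x y"
    using a by auto
qed

(* z y m stands for z(y | C m). The constraints with m = m' force z y m \<ge> 0, since every cell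
   has positive diameter. *)
definition apo_lb_feasible ::
  "real \<Rightarrow> (real ^ 'n::finite \<Rightarrow> real ^ 'n \<Rightarrow> real) \<Rightarrow> nat \<Rightarrow> (nat \<Rightarrow> (real ^ 'n) set) \<Rightarrow> real ^ 'n
     \<Rightarrow> 'y set \<Rightarrow> ('y \<Rightarrow> nat \<Rightarrow> real) set" where
  "apo_lb_feasible \<epsilon> d M C \<Delta> Y =
     {z. (\<forall>m\<in>{1..M}. \<forall>m'\<in>{1..M}. \<forall>y\<in>Y.
            z y m - exp (\<epsilon> * cell_dist d (C m) (C m')) * z y m' \<le> 0) \<and>
         (\<forall>m\<in>{1..M}. (\<Sum>y\<in>Y. z y m) = (\<Prod>i\<in>UNIV. \<Delta> $ i))}"

definition apo_lb_objective ::
  "('x \<Rightarrow> real) \<Rightarrow> ('x \<Rightarrow> 'y \<Rightarrow> real) \<Rightarrow> nat \<Rightarrow> (nat \<Rightarrow> 'x set) \<Rightarrow> 'y set \<Rightarrow> ('y \<Rightarrow> nat \<Rightarrow> real) \<Rightarrow> real" where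
  "apo_lb_objective p L M C Y z = (\<Sum>m=1..M. \<Sum>y\<in>Y. cell_loss p L (C m) y * z y m)"

(* Taken in ereal, so that the infimum has its usual meaning without side conditions. *)
definition apo_lb_value ::
  "real \<Rightarrow> (real ^ 'n::finite \<Rightarrow> real ^ 'n \<Rightarrow> real) \<Rightarrow> (real ^ 'n \<Rightarrow> real) \<Rightarrow> (real ^ 'n \<Rightarrow> 'y \<Rightarrow> real)
     \<Rightarrow> nat \<Rightarrow> (nat \<Rightarrow> (real ^ 'n) set) \<Rightarrow> real ^ 'n \<Rightarrow> 'y set \<Rightarrow> ereal" where
  "apo_lb_value \<epsilon> d p L M C \<Delta> Y =
     (INF z\<in>apo_lb_feasible \<epsilon> d M C \<Delta> Y. ereal (apo_lb_objective p L M C Y z))"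

(* The Bochner integral is 0 on non-integrable functions. The expected loss below may genuinely
   be +\<infinity>, so it uses the extended-valued integral; the case \<infinity> - \<infinity> cannot occur for
   integrands bounded below on a set of finite measure. *)
definition extended_integral :: "'x measure \<Rightarrow> ('x \<Rightarrow> real) \<Rightarrow> ereal" where
  "extended_integral \<mu> f =
     enn2ereal (\<integral>\<^sup>+ x. ennreal (f x) \<partial>\<mu>) - enn2ereal (\<integral>\<^sup>+ x. ennreal (- f x) \<partial>\<mu>)"

lemma extended_integral_eq_lebesgue_integral:
  assumes "integrable \<mu> f"
  shows "extended_integral \<mu> f = ereal (\<integral>x. f x \<partial>\<mu>)"
proof -
  have fin: "(\<integral>\<^sup>+ x. ennreal (f x) \<partial>\<mu>) \<noteq> \<infinity>"
      "(\<integral>\<^sup>+ x. ennreal (- f x) \<partial>\<mu>) \<noteq> \<infinity>"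
    using assms by (simp_all add: real_integrable_def)
  have conv: "enn2ereal a = ereal (enn2real a)" if "a \<noteq> \<infinity>" for a
    using that by (cases a) (simp_all add: enn2ereal_ennreal)
  show ?thesis
    unfolding extended_integral_def real_lebesgue_integral_def[OF assms]
    by (simp only: conv[OF fin(1)] conv[OF fin(2)] ereal_minus)
qed

definition expected_loss ::
  "'x::euclidean_space set \<Rightarrow> 'y set \<Rightarrow> ('x \<Rightarrow> real) \<Rightarrow> ('x \<Rightarrow> 'y \<Rightarrow> real) \<Rightarrow> ('x \<Rightarrow> 'y pmf) \<Rightarrow> ereal" where
  "expected_loss X Y p L K =
     extended_integral (lebesgue_on X) (\<lambda>x. \<Sum>y\<in>Y. p x * L x y * pmf (K x) y)"

end

theory Submission
  imports Defs
begin

text \<open>Given a mechanism \<open>K\<close>, the integrals \<open>z y m = \<integral>\<^bsub>C m\<^esub> Pr (K x = y) dx\<close> form a feasible point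
  of the linear program: the privacy constraint survives integration over pairs of cells because all
  cells have the same volume. On every cell the loss dominates its minimum, and the overlaps of the
  cells are null sets, so the expected loss is at least the objective at \<open>z\<close>. Measurability
  of the mechanism is automatic, since privacy makes its probabilities continuous.\<close>

text \<open>Each coordinate difference is at most the Euclidean norm, so for finite exponent
  \<open>r\<close> the root of the power sum is at most \<open>CARD('n) powr (1 / r)\<close> times
  that norm, and \<open>1 / r \<le> 1\<close>. The crude constant does for every exponent; only
  boundedness and continuity are drawn from it.\<close>

lemma lp_dist_le_norm:
  fixes x y :: "real ^ 'n::finite"
  assumes "1 \<le> q"
  shows "lp_dist q x y \<le> real CARD('n) * norm (x - y)"
proof -
  have card: "1 \<le> real CARD('n)" by (simp add: Suc_leI)
  have comp: "\<bar>x $ i - y $ i\<bar> \<le> norm (x - y)" for i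
    using component_le_norm_cart[of "x - y" i] by simp
  show ?thesis
  proof (cases "q = \<infinity>")
    case True
    have "(MAX i. \<bar>x $ i - y $ i\<bar>) \<le> norm (x - y)"
      using comp by (subst Max_le_iff) auto
    also have "\<dots> \<le> real CARD('n) * norm (x - y)"
      using mult_right_mono[OF card norm_ge_zero[of "x - y"]] by simp
    finally show ?thesis using True by (simp add: lp_dist_def)
  next
    case False
    then obtain r where r: "q = ereal r" "1 \<le> r"
      using assms by (cases q) (auto simp: one_ereal_def)
    have "(\<Sum>i\<in>UNIV. \<bar>x $ i - y $ i\<bar> powr r) \<le> (\<Sum>i\<in>(UNIV :: 'n set). norm (x - y) powr r)"
      using r comp by (intro sum_mono powr_mono2) auto
    then have "(\<Sum>i\<in>UNIV. \<bar>x $ i - y $ i\<bar> powr r) powr (1 / r)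
        \<le> (real CARD('n) * norm (x - y) powr r) powr (1 / r)"
      using r by (intro powr_mono2) (auto intro: sum_nonneg)
    also have "\<dots> = real CARD('n) powr (1 / r) * norm (x - y)"
      using r by (simp add: powr_mult powr_powr)
    also have "\<dots> \<le> real CARD('n) powr 1 * norm (x - y)"
      using r card by (intro mult_right_mono powr_mono) auto
    finally show ?thesis using r by (simp add: lp_dist_def)
  qed
qed

text \<open>A real-valued supremum dominates its elements only over a set bounded above; the bounded
  cells provide that bound through \<open>lp_dist_le_norm\<close>.\<close>

lemma lp_dist_le_cell_dist:
  fixes A B :: "(real ^ 'n::finite) set"
  assumes "1 \<le> q" "bounded A" "bounded B" "x \<in> A" "x' \<in> B"
  shows "lp_dist q x x' \<le> cell_dist (lp_dist q) A B"
proof -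
  obtain a b where a: "\<And>x. x \<in> A \<Longrightarrow> norm x \<le> a" and b: "\<And>x. x \<in> B \<Longrightarrow> norm x \<le> b"
    using assms by (auto simp: bounded_iff)
  have "lp_dist q u v \<le> real CARD('n) * (a + b)" if "u \<in> A" "v \<in> B" for u v
  proof -
    have "norm (u - v) \<le> a + b"
      using norm_triangle_ineq4[of u v] a[OF that(1)] b[OF that(2)] by linarith
    then have "real CARD('n) * norm (u - v) \<le> real CARD('n) * (a + b)"
      by (intro mult_left_mono) auto
    then show ?thesis using lp_dist_le_norm[OF assms(1), of u v] by linarith
  qed
  then have "bdd_above ((\<lambda>(x, x'). lp_dist q x x') ` (A \<times> B))"
    by (intro bdd_aboveI2[where M = "real CARD('n) * (a + b)"]) auto
  then show ?thesis
    unfolding cell_dist_def using assms(4,5)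
    by (intro cSUP_upper2[where x = "(x, x')"]) auto
qed

text \<open>Since probabilities are at most 1, the multiplicative privacy bound becomes an additive
  one, \<open>exp (...) - 1\<close>, which vanishes as the points approach each other. Exchanging
  the two points bounds the absolute difference.\<close>

lemma mDP_imp_continuous_on:
  fixes X :: "(real ^ 'n::finite) set"
  assumes "mDP \<epsilon> (lp_dist q) X Y K" "1 \<le> q" "\<epsilon> > 0" "y \<in> Y"
  shows "continuous_on X (\<lambda>x. pmf (K x) y)"
  unfolding continuous_on_def
proof
  fix x assume x: "x \<in> X"
  let ?e = "\<lambda>t. exp (\<epsilon> * (real CARD('n) * norm (t - x))) - 1"
  have upper: "pmf (K a) y - pmf (K b) y \<le> exp (\<epsilon> * (real CARD('n) * norm (a - b))) - 1"
    if "a \<in> X" "b \<in> X" for a b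
  proof -
    have "pmf (K a) y \<le> exp (\<epsilon> * lp_dist q a b) * pmf (K b) y"
      using assms that by (auto simp: mDP_def)
    also have "\<dots> \<le> exp (\<epsilon> * (real CARD('n) * norm (a - b))) * pmf (K b) y"
      using assms lp_dist_le_norm[of q a b] by (intro mult_right_mono) auto
    finally have "pmf (K a) y - pmf (K b) y
        \<le> (exp (\<epsilon> * (real CARD('n) * norm (a - b))) - 1) * pmf (K b) y"
      by (simp add: algebra_simps)
    also have "\<dots> \<le> exp (\<epsilon> * (real CARD('n) * norm (a - b))) - 1"
      using assms by (intro mult_left_le) (auto simp: pmf_le_1)
    finally show ?thesis .
  qed
  have "((\<lambda>t. pmf (K t) y - pmf (K x) y) \<longlongrightarrow> 0) (at x within X)"
  proof (rule Lim_null_comparison)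
    show "\<forall>\<^sub>F t in at x within X. norm (pmf (K t) y - pmf (K x) y) \<le> ?e t"
      unfolding eventually_at_filter using upper x
      by (intro always_eventually) (force simp: abs_le_iff norm_minus_commute)
    have "(?e \<longlongrightarrow> exp (\<epsilon> * (real CARD('n) * norm (x - x))) - 1) (at x within X)"
      by (intro tendsto_intros)
    then show "(?e \<longlongrightarrow> 0) (at x within X)" by simp
  qed
  then show "((\<lambda>x. pmf (K x) y) \<longlongrightarrow> pmf (K x) y) (at x within X)"
    by (simp add: LIM_zero_iff)
qed

text \<open>If \<open>f\<close> is not integrable, its extended integral is \<open>+\<infinity>\<close>, as its negative part is integrable.\<close>

lemma extended_integral_ge:
  assumes "f \<in> borel_measurable \<mu>" "finite_measure \<mu>"
    and "\<And>x. x \<in> space \<mu> \<Longrightarrow> - B \<le> f x"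
    and "integrable \<mu> f \<Longrightarrow> c \<le> (\<integral>x. f x \<partial>\<mu>)"
  shows "ereal c \<le> extended_integral \<mu> f"
proof (cases "integrable \<mu> f")
  case True
  then show ?thesis using assms(4) by (simp add: extended_integral_eq_lebesgue_integral)
next
  case False
  interpret finite_measure \<mu> by fact
  \<comment> \<open>\<open>ennreal\<close> truncates at 0, so the integrand on the left is the
    negative part of \<open>f\<close>; a constant dominates it, and the measure is finite.\<close>
  have "(\<integral>\<^sup>+ x. ennreal (- f x) \<partial>\<mu>) \<le> (\<integral>\<^sup>+ x. ennreal B \<partial>\<mu>)"
    using assms(3) by (intro nn_integral_mono ennreal_leI) force
  also have "\<dots> < \<infinity>"
    by (simp add: ennreal_mult_eq_top_iff less_top[symmetric] emeasure_eq_measure)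
  finally have neg: "(\<integral>\<^sup>+ x. ennreal (- f x) \<partial>\<mu>) < \<infinity>" .
  then have pos: "(\<integral>\<^sup>+ x. ennreal (f x) \<partial>\<mu>) = \<infinity>"
    using False assms(1) by (auto simp: real_integrable_def)
  from neg obtain r where "0 \<le> r" "(\<integral>\<^sup>+ x. ennreal (- f x) \<partial>\<mu>) = ennreal r"
    by (cases "\<integral>\<^sup>+ x. ennreal (- f x) \<partial>\<mu>") auto
  then show ?thesis unfolding extended_integral_def pos by (simp add: enn2ereal_ennreal)
qed

text \<open>The interior of the intersection is the intersection of the interiors, and a convex set
  with empty interior is null. This makes the shared faces of cells harmless for
  integration.\<close>

lemma negligible_convex_Int:
  fixes S T :: "'a::euclidean_space set"
  assumes "convex S" "convex T" "interior S \<inter> interior T = {}"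
  shows "negligible (S \<inter> T)"
  using assms by (simp add: negligible_convex_interior convex_Int)

text \<open>Integrating over \<open>x'\<close> with \<open>x\<close> fixed puts the factor
  \<open>V\<close> on the left; integrating over \<open>x\<close> then puts the same factor on the
  right, and it cancels.\<close>

lemma integral_mono_scaled:
  fixes f :: "'a::euclidean_space \<Rightarrow> real"
  assumes "f integrable_on cbox a b" "f integrable_on cbox c d"
    and "\<And>x x'. x \<in> cbox a b \<Longrightarrow> x' \<in> cbox c d \<Longrightarrow> f x \<le> E * f x'"
    and "measure lborel (cbox a b) = V" "measure lborel (cbox c d) = V" "V > 0"
  shows "integral (cbox a b) f \<le> E * integral (cbox c d) f"
proof -
  have "V * f x \<le> E * integral (cbox c d) f" if "x \<in> cbox a b" for x
  proof -
    have "integral (cbox c d) (\<lambda>_. f x) \<le> integral (cbox c d) (\<lambda>x'. E * f x')"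
      using assms that by (intro integral_le) (auto intro: integrable_on_mult_right)
    then show ?thesis using assms by simp
  qed
  then have "integral (cbox a b) (\<lambda>x. V * f x)
      \<le> integral (cbox a b) (\<lambda>_. E * integral (cbox c d) f)"
    using assms by (intro integral_le) (auto intro: integrable_on_mult_right)
  then show ?thesis using assms by simp
qed

theorem proposition5:
  fixes X :: "(real ^ 'n::finite) set"
    and M :: nat
    and C :: "nat \<Rightarrow> (real ^ 'n) set"
    and \<Delta> :: "real ^ 'n"
    and Y :: "'y set"
    and p :: "real ^ 'n \<Rightarrow> real"
    and L :: "real ^ 'n \<Rightarrow> 'y \<Rightarrow> real"
    and \<epsilon> :: real
    and q :: ereal
    and K :: "real ^ 'n \<Rightarrow> 'y pmf"
  assumes "box_partition X M C \<Delta>"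
    and "finite Y"
    and "prior_density X p"
    and "\<And>y. y \<in> Y \<Longrightarrow> (\<lambda>x. p x * L x y) \<in> borel_measurable (lebesgue_on X)"
    and "\<And>y m. y \<in> Y \<Longrightarrow> m \<in> {1..M} \<Longrightarrow> attains_min_on (\<lambda>x. p x * L x y) (C m)"
    and "\<epsilon> > 0"
    and "1 \<le> q"
    and "mechanism X Y K"
    and "mDP \<epsilon> (lp_dist q) X Y K"
  shows "expected_loss X Y p L K \<ge> apo_lb_value \<epsilon> (lp_dist q) p L M C \<Delta> Y"
proof -
  define f where "f = (\<lambda>y x. pmf (K x) y)"
  define z where "z = (\<lambda>y m. integral (C m) (f y))"
  define V where "V = (\<Prod>i\<in>UNIV. \<Delta> $ i)"
  define g where "g = (\<lambda>x. \<Sum>y\<in>Y. p x * L x y * f y x)"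
  from assms(1) have \<Delta>: "\<And>i. 0 < \<Delta> $ i"
    and disj: "disjoint_family_on (\<lambda>m. interior (C m)) {1..M}"
    and X: "X = (\<Union>m\<in>{1..M}. C m)"
    and "\<forall>m\<in>{1..M}. \<exists>a. C m = cbox a (a + \<Delta>)"
    by (auto simp: box_partition_def)
  then obtain a where C: "\<And>m. m \<in> {1..M} \<Longrightarrow> C m = cbox (a m) (a m + \<Delta>)" by metis
  have V: "V > 0" using \<Delta> by (auto simp: V_def intro: prod_pos)
  have vol: "measure lborel (cbox (a m) (a m + \<Delta>)) = V" for m
    using \<Delta> by (subst content_cbox_cart) (auto simp: V_def interval_ne_empty_cart less_imp_le)
  have sub: "C m \<subseteq> X" if "m \<in> {1..M}" for m using that X by blast
  have cont: "continuous_on X (f y)" if "y \<in> Y" for y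
    unfolding f_def using assms(9,7,6) that by (rule mDP_imp_continuous_on)
  have fint: "f y integrable_on C m" if "y \<in> Y" "m \<in> {1..M}" for y m
    using continuous_on_subset[OF cont[OF that(1)] sub[OF that(2)]] C[OF that(2)]
    by (auto intro: integrable_continuous)
  have f_range: "0 \<le> f y x" "f y x \<le> 1" for y x by (auto simp: f_def pmf_le_1)
  have z_feasible: "z \<in> apo_lb_feasible \<epsilon> (lp_dist q) M C \<Delta> Y"
    unfolding apo_lb_feasible_def
  proof (intro CollectI conjI ballI)
    fix m m' y assume m: "m \<in> {1..M}" "m' \<in> {1..M}" and y: "y \<in> Y"
    let ?E = "exp (\<epsilon> * cell_dist (lp_dist q) (C m) (C m'))"
    \<comment> \<open>Privacy at the pair of points, with their distance enlarged to the inter-cell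
      distance, gives a factor that is uniform over both cells.\<close>
    have "f y x \<le> ?E * f y x'" if "x \<in> C m" "x' \<in> C m'" for x x'
    proof -
      have "f y x \<le> exp (\<epsilon> * lp_dist q x x') * f y x'"
        unfolding f_def using assms(9) that m sub y by (force simp: mDP_def)
      also have "\<dots> \<le> ?E * f y x'"
        using assms(6,7) that f_range C m
        by (intro mult_right_mono) (auto intro!: lp_dist_le_cell_dist)
      finally show ?thesis .
    qed
    then have "z y m \<le> ?E * z y m'"
      using fint m y V vol unfolding z_def by (auto simp: C intro!: integral_mono_scaled)
    then show "z y m - ?E * z y m' \<le> 0" by simp
  next
    fix m assume m: "m \<in> {1..M}"
    \<comment> \<open>The mechanism is supported in \<open>Y\<close>, so the probabilities sum to 1
      at every point and only the volume of the cell is left.\<close>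
    have "(\<Sum>y\<in>Y. z y m) = integral (C m) (\<lambda>x. \<Sum>y\<in>Y. f y x)"
      unfolding z_def using fint m assms(2) by (intro integral_sum[symmetric]) auto
    also have "\<dots> = integral (C m) (\<lambda>_. 1)"
      using assms(2,8) sub[OF m]
      by (intro integral_cong) (auto simp: f_def mechanism_def intro!: sum_pmf_eq_1)
    also have "\<dots> = V" using C m vol by simp
    finally show "(\<Sum>y\<in>Y. z y m) = (\<Prod>i\<in>UNIV. \<Delta> $ i)" by (simp add: V_def)
  qed
  have Xl: "X \<in> lmeasurable" unfolding X using C by (intro fmeasurable.finite_UN) auto
  have g_meas: "g \<in> borel_measurable (lebesgue_on X)"
    unfolding g_def
  proof (rule borel_measurable_sum)
    fix y assume y: "y \<in> Y"
    have "f y \<in> borel_measurable (lebesgue_on X)"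
      using cont[OF y] Xl by (intro continuous_imp_measurable_on_sets_lebesgue) auto
    with assms(4)[OF y] show "(\<lambda>x. p x * L x y * f y x) \<in> borel_measurable (lebesgue_on X)"
      by (rule borel_measurable_times)
  qed
  have cell_le: "(\<Sum>y\<in>Y. cell_loss p L (C m) y * f y x) \<le> g x" if "x \<in> C m" "m \<in> {1..M}" for x m
    unfolding g_def
  proof (intro sum_mono mult_right_mono f_range)
    fix y assume "y \<in> Y"
    then show "cell_loss p L (C m) y \<le> p x * L x y"
      using cell_loss_minimum(2)[where L = L and y = y, OF assms(5)] that by blast
  qed
  \<comment> \<open>Cell losses may be negative, hence the absolute values; summing over all cells
    gives one bound for the whole of \<open>X\<close>.\<close>
  define B where "B = (\<Sum>m=1..M. \<Sum>y\<in>Y. \<bar>cell_loss p L (C m) y\<bar>)"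
  have g_lower: "- B \<le> g x" if "x \<in> X" for x
  proof -
    from that X obtain m where m: "m \<in> {1..M}" "x \<in> C m" by blast
    have "- (\<Sum>y\<in>Y. cell_loss p L (C m) y * f y x) \<le> (\<Sum>y\<in>Y. \<bar>cell_loss p L (C m) y\<bar>)"
      unfolding sum_negf[symmetric]
    proof (rule sum_mono)
      fix y
      have "- (cell_loss p L (C m) y * f y x) \<le> \<bar>cell_loss p L (C m) y\<bar> * f y x"
        using f_range[of y x] abs_ge_minus_self[of "cell_loss p L (C m) y * f y x"]
        by (simp add: abs_mult)
      also have "\<dots> \<le> \<bar>cell_loss p L (C m) y\<bar>" using f_range by (intro mult_left_le) auto
      finally show "- (cell_loss p L (C m) y * f y x) \<le> \<bar>cell_loss p L (C m) y\<bar>" .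
    qed
    also have "\<dots> \<le> B" unfolding B_def using m by (intro member_le_sum) (auto intro: sum_nonneg)
    finally show ?thesis using cell_le[OF m(2,1)] by linarith
  qed
  have "ereal (apo_lb_objective p L M C Y z) \<le> extended_integral (lebesgue_on X) g"
  proof (rule extended_integral_ge[where B = B])
    show "finite_measure (lebesgue_on X)" using Xl by (rule finite_measure_lebesgue_on)
    assume g_int: "integrable (lebesgue_on X) g"
    \<comment> \<open>Absolute integrability restricts to the measurable cells and yields gauge
      integrability there, which makes the additivity of the gauge integral over the cells
      available.\<close>
    have gX: "g absolutely_integrable_on X"
      using g_int Xl by (simp add: set_integrable_def integrable_restrict_space)
    have gC: "g integrable_on C m" if "m \<in> {1..M}" for m
      using set_integrable_subset[OF gX] sub[OF that] C[OF that]
      by (auto intro: set_lebesgue_integral_eq_integral(1))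
    \<comment> \<open>Boundary points lie in several cells, but only pairwise negligible overlaps
      are required for the integral to split.\<close>
    have "(g has_integral (\<Sum>m=1..M. integral (C m) g)) (\<Union>m\<in>{1..M}. C m)"
    proof (rule has_integral_UN)
      show "pairwise (\<lambda>m m'. negligible (C m \<inter> C m')) {1..M}"
        using disj unfolding disjoint_family_on_def
        by (intro pairwiseI negligible_convex_Int) (simp_all add: C)
    qed (use gC in auto)
    then have "integral X g = (\<Sum>m=1..M. integral (C m) g)"
      unfolding X by (rule integral_unique)
    moreover have "(\<Sum>y\<in>Y. cell_loss p L (C m) y * z y m) \<le> integral (C m) g"
      if m: "m \<in> {1..M}" for m
    proof -
      have int: "(\<lambda>x. cell_loss p L (C m) y * f y x) integrable_on C m" if "y \<in> Y" for y
        using fint[OF that m] by (rule integrable_on_mult_right)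
      have "(\<Sum>y\<in>Y. cell_loss p L (C m) y * z y m)
          = integral (C m) (\<lambda>x. \<Sum>y\<in>Y. cell_loss p L (C m) y * f y x)"
        unfolding z_def using int assms(2) by (subst integral_sum) auto
      also have "\<dots> \<le> integral (C m) g"
        using int assms(2) gC m cell_le by (intro integral_le integrable_sum) auto
      finally show ?thesis .
    qed
    ultimately have "apo_lb_objective p L M C Y z \<le> integral X g"
      unfolding apo_lb_objective_def by (auto intro: sum_mono)
    also have "integral X g = (\<integral>x. g x \<partial>lebesgue_on X)"
      using g_int Xl by (simp add: lebesgue_integral_eq_integral)
    finally show "apo_lb_objective p L M C Y z \<le> (\<integral>x. g x \<partial>lebesgue_on X)" .
  qed (use g_meas g_lower in auto)
  also have "\<dots> = expected_loss X Y p L K" by (simp add: expected_loss_def g_def f_def)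
  \<comment> \<open>Optimality of \<open>z\<close> is not at issue: the infimum lies below the
    objective at any feasible point.\<close>
  finally show ?thesis
    unfolding apo_lb_value_def using z_feasible by (rule INF_lower2[rotated])
qed

end
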